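(* Let $F \subseteq \{\land,\lor,\to,\neg\}$ be a fragment of intuitionistic propositional logic with $\to\, \in F$. Then $F$ does not have a finite semantics; that is, there do not exist an algebra $\mathfrak{A}_F$ with finite universe $V$ and a subset $D \subseteq V$ such that for every $\Gamma \cup \{\varphi\} \subseteq \mathfrak{F}_F$ one has $\Gamma \vdash_F \varphi$ if and only if $\Gamma \vDash_{\mathfrak{A}_F, D} \varphi$.
   Context: Let $\Pi$ be an infinite set of propositional letters, containing distinct letters $p_1, p_2, \dots$. The set $\mathfrak{F}$ of formulas is built from $\Pi$ with the binary connectives $\land, \lor, \to$ and the unary connective $\neg$. A fragment is any subset $F$ of $\{\land,\lor,\to,\neg\}$; $\mathfrak{F}_F$ is the set of formulas built from $\Pi$ using only connectives in $F$. Derivability $\vdash_F$ is the smallest relation between sets of formulas of $\mathfrak{F}_F$ and formulas of $\mathfrak{F}_F$ satisfying the structural rules (R$_\in$), (R$_m$), (R$_t$) and those of the other rules below that concern connectives in $F$: (R$_\in$) if $\varphi \in \Gamma$, then $\Gamma \vdash \varphi$; (R$_m$) if $\Gamma \vdash \varphi$, then $\Gamma, \psi \vdash \varphi$; (R$_t$) if $\Gamma \vdash \varphi$ and $\Delta, \varphi \vdash \psi$, then $\Gamma, \Delta \vdash \psi$; (R$_\land$) $\Gamma \vdash \varphi \land \psi$ iff $\Gamma \vdash \varphi$ and $\Gamma \vdash \psi$; (R$_\lor$) $\Gamma, \varphi \lor \psi \vdash \chi$ iff $\Gamma, \varphi \vdash \chi$ and $\Gamma, \psi \vdash \chi$; (R$_\to$)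 $\Gamma \vdash \varphi \to \psi$ iff $\Gamma, \varphi \vdash \psi$; (R$_{\neg I}$) if $\Gamma, \varphi \vdash \psi$ and $\Gamma, \varphi \vdash \neg\psi$, then $\Gamma \vdash \neg\varphi$; (R$_{\neg E}$) if $\Gamma \vdash \varphi$ and $\Gamma \vdash \neg\varphi$, then $\Gamma \vdash \psi$. An algebra $\mathfrak{A}_F$ for $F$ has a nonempty universe $V$ and one operation on $V$ of the corresponding arity for each connective in $F$. For $D \subseteq V$ and $\Gamma \cup \{\varphi\} \subseteq \mathfrak{F}_F$, $\Gamma \vDash_{\mathfrak{A}_F, D} \varphi$ means: for every assignment $v : \Pi \to V$, with unique homomorphic extension $\bar v : \mathfrak{F}_F \to V$, if $\bar v(\psi) \in D$ for all $\psi \in \Gamma$, then $\bar v(\varphi) \in D$. *)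

theory Defs
  imports Main
begin

datatype connective = C_And | C_Or | C_Imp | C_Neg

(* The propositional letters are the elements of the type 'p. *)
datatype 'p fm =
    Letter 'p
  | And "'p fm" "'p fm"
  | Or "'p fm" "'p fm"
  | Imp "'p fm" "'p fm"
  | Neg "'p fm"

primrec connectives :: "'p fm \<Rightarrow> connective set" where
  "connectives (Letter p) = {}"
| "connectives (And \<phi> \<psi>) = {C_And} \<union> connectives \<phi> \<union> connectives \<psi>"
| "connectives (Or \<phi> \<psi>) = {C_Or} \<union> connectives \<phi> \<union> connectives \<psi>"
| "connectives (Imp \<phi> \<psi>) = {C_Imp} \<union> connectives \<phi> \<union> connectives \<psi>"
| "connectives (Neg \<phi>) = {C_Neg} \<union> connectives \<phi>"

definition formulas :: "connective set \<Rightarrow> 'p fm set" where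
  "formulas F = {\<phi>. connectives \<phi> \<subseteq> F}"

(* The membership conditions appear only where the premises do not already
   force the conclusion to consist of formulas of the fragment; see
   derives_formulas below. *)
inductive derives :: "connective set \<Rightarrow> 'p fm set \<Rightarrow> 'p fm \<Rightarrow> bool" for F where
  R_in: "\<Gamma> \<subseteq> formulas F \<Longrightarrow> \<phi> \<in> \<Gamma> \<Longrightarrow> derives F \<Gamma> \<phi>"
| R_m: "derives F \<Gamma> \<phi> \<Longrightarrow> \<psi> \<in> formulas F \<Longrightarrow> derives F (insert \<psi> \<Gamma>) \<phi>"
| R_t: "derives F \<Gamma> \<phi> \<Longrightarrow> derives F (insert \<phi> \<Delta>) \<psi> \<Longrightarrow> derives F (\<Gamma> \<union> \<Delta>) \<psi>"
| R_and_I: "C_And \<in> F \<Longrightarrow> derives F \<Gamma> \<phi> \<Longrightarrow> derives F \<Gamma> \<psi> \<Longrightarrow> derives F \<Gamma> (And \<phi> \<psi>)"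
| R_and_E1: "C_And \<in> F \<Longrightarrow> derives F \<Gamma> (And \<phi> \<psi>) \<Longrightarrow> derives F \<Gamma> \<phi>"
| R_and_E2: "C_And \<in> F \<Longrightarrow> derives F \<Gamma> (And \<phi> \<psi>) \<Longrightarrow> derives F \<Gamma> \<psi>"
| R_or_L: "C_Or \<in> F \<Longrightarrow> derives F (insert \<phi> \<Gamma>) \<chi> \<Longrightarrow> derives F (insert \<psi> \<Gamma>) \<chi> \<Longrightarrow>
    derives F (insert (Or \<phi> \<psi>) \<Gamma>) \<chi>"
| R_or_inv1: "C_Or \<in> F \<Longrightarrow> derives F (insert (Or \<phi> \<psi>) \<Gamma>) \<chi> \<Longrightarrow> derives F (insert \<phi> \<Gamma>) \<chi>"
| R_or_inv2: "C_Or \<in> F \<Longrightarrow> derives F (insert (Or \<phi> \<psi>) \<Gamma>) \<chi> \<Longrightarrow> derives F (insert \<psi> \<Gamma>) \<chi>"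
| R_imp_I: "C_Imp \<in> F \<Longrightarrow> derives F (insert \<phi> \<Gamma>) \<psi> \<Longrightarrow> derives F \<Gamma> (Imp \<phi> \<psi>)"
| R_imp_E: "C_Imp \<in> F \<Longrightarrow> derives F \<Gamma> (Imp \<phi> \<psi>) \<Longrightarrow> derives F (insert \<phi> \<Gamma>) \<psi>"
| R_neg_I: "C_Neg \<in> F \<Longrightarrow> derives F (insert \<phi> \<Gamma>) \<psi> \<Longrightarrow> derives F (insert \<phi> \<Gamma>) (Neg \<psi>) \<Longrightarrow>
    derives F \<Gamma> (Neg \<phi>)"
| R_neg_E: "C_Neg \<in> F \<Longrightarrow> derives F \<Gamma> \<phi> \<Longrightarrow> derives F \<Gamma> (Neg \<phi>) \<Longrightarrow> \<psi> \<in> formulas F \<Longrightarrow>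
    derives F \<Gamma> \<psi>"

lemma derives_formulas: "derives F \<Gamma> \<phi> \<Longrightarrow> \<Gamma> \<subseteq> formulas F \<and> \<phi> \<in> formulas F"
  by (induction rule: derives.induct) (auto simp: formulas_def)

(* Operations for connectives outside the fragment F are unconstrained and
   play no role: they are not used in evaluating formulas of the fragment. *)
record 'v algebra =
  universe :: "'v set"
  op_and :: "'v \<Rightarrow> 'v \<Rightarrow> 'v"
  op_or :: "'v \<Rightarrow> 'v \<Rightarrow> 'v"
  op_imp :: "'v \<Rightarrow> 'v \<Rightarrow> 'v"
  op_neg :: "'v \<Rightarrow> 'v"

definition algebra_for :: "connective set \<Rightarrow> 'v algebra \<Rightarrow> bool" where
  "algebra_for F \<AA> \<longleftrightarrow>
     universe \<AA> \<noteq> {} \<and>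
     (C_And \<in> F \<longrightarrow> (\<forall>x\<in>universe \<AA>. \<forall>y\<in>universe \<AA>. op_and \<AA> x y \<in> universe \<AA>)) \<and>
     (C_Or \<in> F \<longrightarrow> (\<forall>x\<in>universe \<AA>. \<forall>y\<in>universe \<AA>. op_or \<AA> x y \<in> universe \<AA>)) \<and>
     (C_Imp \<in> F \<longrightarrow> (\<forall>x\<in>universe \<AA>. \<forall>y\<in>universe \<AA>. op_imp \<AA> x y \<in> universe \<AA>)) \<and>
     (C_Neg \<in> F \<longrightarrow> (\<forall>x\<in>universe \<AA>. op_neg \<AA> x \<in> universe \<AA>))"

primrec eval_fm :: "'v algebra \<Rightarrow> ('p \<Rightarrow> 'v) \<Rightarrow> 'p fm \<Rightarrow> 'v" where
  "eval_fm \<AA> v (Letter p) = v p"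
| "eval_fm \<AA> v (And \<phi> \<psi>) = op_and \<AA> (eval_fm \<AA> v \<phi>) (eval_fm \<AA> v \<psi>)"
| "eval_fm \<AA> v (Or \<phi> \<psi>) = op_or \<AA> (eval_fm \<AA> v \<phi>) (eval_fm \<AA> v \<psi>)"
| "eval_fm \<AA> v (Imp \<phi> \<psi>) = op_imp \<AA> (eval_fm \<AA> v \<phi>) (eval_fm \<AA> v \<psi>)"
| "eval_fm \<AA> v (Neg \<phi>) = op_neg \<AA> (eval_fm \<AA> v \<phi>)"

lemma eval_fm_in_universe:
  assumes "algebra_for F \<AA>" "range v \<subseteq> universe \<AA>" "\<phi> \<in> formulas F"
  shows "eval_fm \<AA> v \<phi> \<in> universe \<AA>"
  using assms(3) by (induction \<phi>) (use assms(1,2) in \<open>auto simp: algebra_for_def formulas_def\<close>)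

definition entails :: "'v algebra \<Rightarrow> 'v set \<Rightarrow> 'p fm set \<Rightarrow> 'p fm \<Rightarrow> bool" where
  "entails \<AA> D \<Gamma> \<phi> \<longleftrightarrow>
     (\<forall>v. range v \<subseteq> universe \<AA> \<longrightarrow> (\<forall>\<psi>\<in>\<Gamma>. eval_fm \<AA> v \<psi> \<in> D) \<longrightarrow> eval_fm \<AA> v \<phi> \<in> D)"

end

theory Submission
  imports Defs
begin

text \<open>
  Goedel separated intuitionistic logic from every finite semantics by the disjunction of all
  equivalences between \<open>n + 1\<close> letters: in an algebra with at most \<open>n\<close> elements two of the letters
  must receive the same value. Without disjunction, that some \<open>a \<rightarrow> b\<close> holds can still be said in the
  form it takes as a premise: everything that follows from each \<open>a \<rightarrow> b\<close> holds. So fix a letter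
  \<open>q\<close> and let \<open>\<Gamma>\<close> consist of all formulas \<open>(a \<rightarrow> b) \<rightarrow> q\<close> with \<open>a\<close>, \<open>b\<close>, \<open>q\<close> distinct letters;
  the question is whether \<open>q\<close> follows.

  A finite semantics would have to say that it does: two letters \<open>a\<close> and \<open>b\<close> other than \<open>q\<close> share a
  value, so the premise \<open>(a \<rightarrow> b) \<rightarrow> q\<close> has the same value as \<open>(a \<rightarrow> a) \<rightarrow> q\<close>, and \<open>q\<close> is derivable
  from the latter (\<open>derives_self_imp_imp\<close>). But \<open>q\<close> is not derivable from \<open>\<Gamma>\<close>, whatever
  other connectives the fragment contains: a Kripke model in which the root lies below one leaf per
  letter refutes it (\<open>distinct_letters_not_derives\<close>), since Kripke models are sound
  for every fragment (\<open>forces_sound\<close>).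
\<close>

primrec forces :: "('w \<Rightarrow> 'w \<Rightarrow> bool) \<Rightarrow> ('w \<Rightarrow> 'p \<Rightarrow> bool) \<Rightarrow> 'w \<Rightarrow> 'p fm \<Rightarrow> bool" where
  "forces R V w (Letter p) \<longleftrightarrow> V w p"
| "forces R V w (And \<phi> \<psi>) \<longleftrightarrow> forces R V w \<phi> \<and> forces R V w \<psi>"
| "forces R V w (Or \<phi> \<psi>) \<longleftrightarrow> forces R V w \<phi> \<or> forces R V w \<psi>"
| "forces R V w (Imp \<phi> \<psi>) \<longleftrightarrow> (\<forall>u. R w u \<longrightarrow> forces R V u \<phi> \<longrightarrow> forces R V u \<psi>)"
| "forces R V w (Neg \<phi>) \<longleftrightarrow> (\<forall>u. R w u \<longrightarrow> \<not> forces R V u \<phi>)"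

definition kripke_model :: "('w \<Rightarrow> 'w \<Rightarrow> bool) \<Rightarrow> ('w \<Rightarrow> 'p \<Rightarrow> bool) \<Rightarrow> bool" where
  "kripke_model R V \<longleftrightarrow> reflp R \<and> transp R \<and> (\<forall>w u p. R w u \<longrightarrow> V w p \<longrightarrow> V u p)"

lemma forces_mono:
  assumes "kripke_model R V" "R w u" "forces R V w \<phi>"
  shows "forces R V u \<phi>"
  using assms(2,3)
  by (induction \<phi> arbitrary: w u)
    (use assms(1) in \<open>auto simp: kripke_model_def dest: transpD\<close>)

lemma forces_sound:
  assumes "kripke_model R V" "derives F \<Gamma> \<phi>" "\<And>\<psi>. \<psi> \<in> \<Gamma> \<Longrightarrow> forces R V w \<psi>"
  shows "forces R V w \<phi>"
proof -
  have refl: "R u u" for u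
    using assms(1) by (auto simp: kripke_model_def dest: reflpD)
  have mono: "forces R V u \<psi>" if "R w u" "forces R V w \<psi>" for w u \<psi>
    using forces_mono[OF assms(1)] that .
  from assms(2) have "\<forall>w. (\<forall>\<psi>\<in>\<Gamma>. forces R V w \<psi>) \<longrightarrow> forces R V w \<phi>"
  proof (induction rule: derives.induct)
    case (R_imp_I \<phi> \<Gamma> \<psi>)
    then show ?case using mono by simp
  next
    case (R_imp_E \<Gamma> \<phi> \<psi>)
    then show ?case using refl by simp blast
  next
    case (R_neg_I \<phi> \<Gamma> \<psi>)
    show ?case
    proof (intro allI impI)
      fix w assume prems: "\<forall>\<psi>\<in>\<Gamma>. forces R V w \<psi>"
      have "\<not> forces R V u \<phi>" if "R w u" for u
      proof
        assume "forces R V u \<phi>"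
        moreover have "\<forall>\<psi>\<in>\<Gamma>. forces R V u \<psi>"
          using prems mono[OF that] by blast
        ultimately have "forces R V u \<psi>" "forces R V u (Neg \<psi>)"
          using R_neg_I.IH by simp_all
        then show False using refl by auto
      qed
      then show "forces R V w (Neg \<phi>)" by simp
    qed
  next
    case (R_neg_E \<Gamma> \<phi> \<psi>)
    then show ?case using refl by fastforce
  qed (simp_all, blast?)
  with assms(3) show ?thesis by blast
qed

lemma derives_self_imp_imp:
  assumes "C_Imp \<in> F" "\<phi> \<in> formulas F" "\<psi> \<in> formulas F"
  shows "derives F {Imp (Imp \<phi> \<phi>) \<psi>} \<psi>"
proof -
  have "derives F {\<phi>} \<phi>"
    using assms by (intro R_in) auto
  then have "derives F {} (Imp \<phi> \<phi>)"
    by (rule R_imp_I[OF assms(1)])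
  moreover have "derives F {Imp (Imp \<phi> \<phi>) \<psi>} (Imp (Imp \<phi> \<phi>) \<psi>)"
    using assms by (intro R_in) (auto simp: formulas_def)
  then have "derives F (insert (Imp \<phi> \<phi>) {Imp (Imp \<phi> \<phi>) \<psi>}) \<psi>"
    by (rule R_imp_E[OF assms(1)])
  ultimately show ?thesis
    using R_t by fastforce
qed

definition distinct_letters :: "'p \<Rightarrow> 'p fm set" where
  "distinct_letters q =
    {Imp (Imp (Letter a) (Letter b)) (Letter q) | a b. a \<noteq> b \<and> a \<noteq> q \<and> b \<noteq> q}"

lemma distinct_letters_formulas: "C_Imp \<in> F \<Longrightarrow> distinct_letters q \<subseteq> formulas F"
  by (auto simp: distinct_letters_def formulas_def)

text \<open>
  At the leaf of \<open>a\<close> exactly \<open>a\<close> and \<open>q\<close> hold, and at the root no letter holds. The leaf of \<open>a\<close>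
  prevents the root from forcing \<open>a \<rightarrow> b\<close>; at the leaves the premises hold because
  \<open>q\<close> does. Hence the root forces all premises but not \<open>q\<close>.
\<close>

lemma distinct_letters_not_derives: "\<not> derives F (distinct_letters q) (Letter q)"
proof
  assume derivable: "derives F (distinct_letters q) (Letter q)"
  \<comment> \<open>The root is \<open>None\<close>, and \<open>Some a\<close> is the leaf of \<open>a\<close>.\<close>
  define R :: "'a option \<Rightarrow> 'a option \<Rightarrow> bool" where "R = (\<lambda>w u. w = None \<or> w = u)"
  define V :: "'a option \<Rightarrow> 'a \<Rightarrow> bool" where "V = (\<lambda>w p. \<exists>a. w = Some a \<and> (p = a \<or> p = q))"
  have "kripke_model R V"
    by (auto simp: kripke_model_def R_def V_def intro!: reflpI transpI)
  moreover have "forces R V None \<psi>" if \<psi>: "\<psi> \<in> distinct_letters q" for \<psi>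
  proof -
    obtain a b where ab: "\<psi> = Imp (Imp (Letter a) (Letter b)) (Letter q)" "a \<noteq> b" "b \<noteq> q"
      using \<psi> by (auto simp: distinct_letters_def)
    have "forces R V u (Letter q)" if "forces R V u (Imp (Letter a) (Letter b))" for u
    proof (cases u)
      case None
      with that have "V (Some a) a \<longrightarrow> V (Some a) b"
        by (simp add: R_def)
      with ab show ?thesis by (simp add: V_def)
    qed (simp add: V_def)
    with ab show ?thesis by simp
  qed
  ultimately have "forces R V None (Letter q)"
    using derivable by (blast intro: forces_sound)
  then show False by (simp add: V_def)
qed

text \<open>
  Each assignment gives some distinct letters \<open>a\<close> and \<open>b\<close> the same value, and then cannot tell the
  premise \<open>(a \<rightarrow> b) \<rightarrow> q\<close> from \<open>(a \<rightarrow> a) \<rightarrow> q\<close>, which entails \<open>q\<close>.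
\<close>

lemma finite_algebra_entails_distinct_letters:
  fixes \<AA> :: "'v algebra" and q :: 'p
  assumes "infinite (UNIV :: 'p set)" "finite (universe \<AA>)"
    and sound: "\<And>a. entails \<AA> D {Imp (Imp (Letter a) (Letter a)) (Letter q)} (Letter q)"
  shows "entails \<AA> D (distinct_letters q) (Letter q)"
  unfolding entails_def
proof (intro allI impI)
  fix v :: "'p \<Rightarrow> 'v"
  assume v: "range v \<subseteq> universe \<AA>" and prems: "\<forall>\<psi>\<in>distinct_letters q. eval_fm \<AA> v \<psi> \<in> D"
  have "finite (v ` (UNIV - {q}))"
    using v assms(2) by (auto intro: finite_subset)
  moreover have "infinite (UNIV - {q} :: 'p set)"
    using assms(1) by simp
  ultimately have "\<not> inj_on v (UNIV - {q})"
    using finite_imageD by blast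
  then obtain a b where ab: "a \<noteq> b" "a \<noteq> q" "b \<noteq> q" "v a = v b"
    by (auto simp: inj_on_def)
  then have "eval_fm \<AA> v (Imp (Imp (Letter a) (Letter b)) (Letter q)) \<in> D"
    using prems unfolding distinct_letters_def by blast
  then have "eval_fm \<AA> v (Imp (Imp (Letter a) (Letter a)) (Letter q)) \<in> D"
    using ab(4) by simp
  with sound[of a] v show "eval_fm \<AA> v (Letter q) \<in> D"
    unfolding entails_def by blast
qed

theorem theorem1:
  fixes F :: "connective set"
  assumes "infinite (UNIV :: 'p set)"
    and "C_Imp \<in> F"
  shows "\<not> (\<exists>(\<AA> :: 'v algebra) D.
    algebra_for F \<AA> \<and> finite (universe \<AA>) \<and> D \<subseteq> universe \<AA> \<and>
    (\<forall>(\<Gamma> :: 'p fm set) \<phi>. \<Gamma> \<union> {\<phi>} \<subseteq> formulas F \<longrightarrow>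
      (derives F \<Gamma> \<phi> \<longleftrightarrow> entails \<AA> D \<Gamma> \<phi>)))"
proof
  assume "\<exists>(\<AA> :: 'v algebra) D.
    algebra_for F \<AA> \<and> finite (universe \<AA>) \<and> D \<subseteq> universe \<AA> \<and>
    (\<forall>(\<Gamma> :: 'p fm set) \<phi>. \<Gamma> \<union> {\<phi>} \<subseteq> formulas F \<longrightarrow>
      (derives F \<Gamma> \<phi> \<longleftrightarrow> entails \<AA> D \<Gamma> \<phi>))"
  then obtain \<AA> :: "'v algebra" and D where fin: "finite (universe \<AA>)"
    and adequate: "\<And>(\<Gamma> :: 'p fm set) \<phi>. \<Gamma> \<union> {\<phi>} \<subseteq> formulas F \<Longrightarrow>
      derives F \<Gamma> \<phi> \<longleftrightarrow> entails \<AA> D \<Gamma> \<phi>"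
    by blast
  fix q :: 'p
  have letter: "Letter p \<in> formulas F" for p :: 'p
    by (simp add: formulas_def)
  have "entails \<AA> D {Imp (Imp (Letter a) (Letter a)) (Letter q)} (Letter q)" for a
    using derives_self_imp_imp[OF assms(2) letter letter, of a q] derives_formulas adequate
    by blast
  then have "entails \<AA> D (distinct_letters q) (Letter q)"
    by (rule finite_algebra_entails_distinct_letters[OF assms(1) fin])
  moreover have "distinct_letters q \<union> {Letter q} \<subseteq> formulas F"
    using distinct_letters_formulas[OF assms(2)] letter by simp
  ultimately have "derives F (distinct_letters q) (Letter q)"
    using adequate by blast
  then show False
    by (simp add: distinct_letters_not_derives)
qed

end
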